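(* Let $0<p\le 1$, $q=1-p$, let $n\ge 2$, and let $\omega=\omega_1\omega_2\cdots\omega_n$ be a sample of $n$ independent identically distributed geometric random variables with $P\{\omega_j=k\}=pq^{k-1}$ for all integers $k\ge 1$. Then: (1) the expected value of the number $\mathrm{sp}(\omega)$ of symmetric peaks is $$\frac{p^2q}{1-q^3}(n-2);$$ (2) the expected value of the number $\mathrm{sv}(\omega)$ of symmetric valleys is $$p^2\left(\frac{1}{1-q^2}-\frac{1}{1-q^3}\right)(n-2);$$ (3) the expected value of the sum $\mathrm{hsp}(\omega)$ of the heights of symmetric peaks is $$\frac{pq}{1-q^3}(n-2);$$ (4) the expected value of the sum $\mathrm{dsv}(\omega)$ of the depths of symmetric valleys is $$q\left(\frac{p}{1-q^3}-\frac{1}{(1+q)^2}\right)(n-2).$$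
   Context: For a word $\omega=\omega_1\omega_2\cdots\omega_n$ of positive integers, a symmetric peak (respectively symmetric valley) is a triple of consecutive letters $\omega_i\omega_{i+1}\omega_{i+2}$, $1\le i\le n-2$, with $\omega_i=\omega_{i+2}$ and $\omega_i<\omega_{i+1}$ (respectively $\omega_i>\omega_{i+1}$). The height of a symmetric peak is $\omega_{i+1}-\omega_i$; the depth of a symmetric valley is $\omega_i-\omega_{i+1}$. $\mathrm{sp}(\omega)$ and $\mathrm{sv}(\omega)$ are the numbers of symmetric peaks and symmetric valleys of $\omega$ (counted by position $i$); $\mathrm{hsp}(\omega)$ is the sum of the heights of all symmetric peaks of $\omega$, and $\mathrm{dsv}(\omega)$ is the sum of the depths of all symmetric valleys of $\omega$. (When $p=1$, $q=0$, the convention $q^0=1$ is used.) *)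

theory Defs
  imports "HOL-Probability.Probability"
begin

text \<open>
  Words are lists of natural numbers and list positions start at 0, so position \<open>i\<close> below is
  the position \<open>i + 1\<close> of the informal convention; the triple starting there has to lie
  inside the word.
\<close>

definition symmetric_peaks :: "nat list \<Rightarrow> nat set" where
  "symmetric_peaks w = {i. i + 2 < length w \<and> w ! i = w ! (i + 2) \<and> w ! i < w ! (i + 1)}"

definition symmetric_valleys :: "nat list \<Rightarrow> nat set" where
  "symmetric_valleys w = {i. i + 2 < length w \<and> w ! i = w ! (i + 2) \<and> w ! i > w ! (i + 1)}"

definition sp :: "nat list \<Rightarrow> nat" where
  "sp w = card (symmetric_peaks w)"

definition sv :: "nat list \<Rightarrow> nat" where
  "sv w = card (symmetric_valleys w)"

text \<open>
  The subtractions of natural numbers below are never truncated, by the inequality in the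
  definition of a peak or valley.
\<close>

definition hsp :: "nat list \<Rightarrow> nat" where
  "hsp w = (\<Sum>i\<in>symmetric_peaks w. w ! (i + 1) - w ! i)"

definition dsv :: "nat list \<Rightarrow> nat" where
  "dsv w = (\<Sum>i\<in>symmetric_valleys w. w ! i - w ! (i + 1))"

definition sample_word :: "(nat \<Rightarrow> 'a \<Rightarrow> nat) \<Rightarrow> nat \<Rightarrow> 'a \<Rightarrow> nat list" where
  "sample_word X n x = map (\<lambda>j. X j x) [1..<n + 1]"

end

theory Submission
  imports Defs
begin

text \<open>
  Each of the four statistics is a sum over the \<open>n - 2\<close> windows of three consecutive letters,
  of a weight \<open>c\<close> of the height or depth if the window is a symmetric peak or valley: \<open>c\<close> is
  the constant 1 for counting and the identity for adding up. Overlapping windows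
  are dependent in general, but by linearity of expectation the mean of one window is enough.

  Let \<open>i + 1\<close> be the smaller of the two values in a window and let \<open>d + 1\<close> be the height or
  depth. The pair \<open>(i, d)\<close> of natural numbers determines the window. A peak is
  \<open>(i + 1, i + d + 2, i + 1)\<close>, a valley is \<open>(i + d + 2, i + 1, i + d + 2)\<close>, and by independence of
  the three letters their probabilities are \<open>p ^ 3 * q ^ (3 * i) * r ^ (d + 1)\<close>, where \<open>r = q\<close> for a
  peak, in which one letter carries the excess, and \<open>r = q\<^sup>2\<close> for a valley, in which two do. The
  sum over \<open>i\<close> and \<open>d\<close> therefore factors, and in all four cases the mean of one window is
  \<open>p ^ 3 / (1 - q ^ 3) * (\<Sum>d. c (d + 1) * r ^ (d + 1))\<close>.
  This is \<open>has_bochner_integral_triple\<close>. The remaining series is \<open>r / (1 - r)\<close> for counting and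
  \<open>r / (1 - r)\<^sup>2\<close> for adding up, and the four closed forms follow from \<open>p = 1 - q\<close>.

  The letters are natural numbers whose law is given only at positive values. These
  probabilities add up to 1, so almost surely no letter is 0 (\<open>AE_letter_pos\<close>) and the windows
  indexed by \<open>(i, d)\<close> account for everything up to a null set.
\<close>

section \<open>Window sums\<close>

definition peak_weight :: "(nat \<Rightarrow> real) \<Rightarrow> nat \<Rightarrow> nat \<Rightarrow> nat \<Rightarrow> real" where
  "peak_weight c a b a' = (if a = a' \<and> a < b then c (b - a) else 0)"

definition valley_weight :: "(nat \<Rightarrow> real) \<Rightarrow> nat \<Rightarrow> nat \<Rightarrow> nat \<Rightarrow> real" where
  "valley_weight c a b a' = (if a = a' \<and> b < a then c (a - b) else 0)"

text \<open>
  The set of peak positions depends on the word. The next two lemmas trade it for a fixed range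
  of positions, so that linearity of expectation applies.
\<close>

lemma sum_symmetric_peaks:
  "(\<Sum>i\<in>symmetric_peaks w. c (w ! (i + 1) - w ! i)) =
    (\<Sum>i<length w - 2. peak_weight c (w ! i) (w ! (i + 1)) (w ! (i + 2)))"
  unfolding symmetric_peaks_def peak_weight_def
  by (rule sum.mono_neutral_cong_left) auto

lemma sum_symmetric_valleys:
  "(\<Sum>i\<in>symmetric_valleys w. c (w ! i - w ! (i + 1))) =
    (\<Sum>i<length w - 2. valley_weight c (w ! i) (w ! (i + 1)) (w ! (i + 2)))"
  unfolding symmetric_valleys_def valley_weight_def
  by (rule sum.mono_neutral_cong_left) auto

lemma nth_sample_word: "i < n \<Longrightarrow> sample_word X n x ! i = X (i + 1) x"
  by (simp add: sample_word_def del: upt_Suc)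

lemma suminf_single_ennreal:
  fixes f :: "nat \<Rightarrow> ennreal"
  assumes "\<And>i. i \<noteq> i0 \<Longrightarrow> f i = 0"
  shows "suminf f = f i0"
  using suminf_finite[of "{i0}" f] assms by auto

section \<open>Samples of geometric letters\<close>

locale geometric_sample = prob_space M for M :: "'a measure" +
  fixes X :: "nat \<Rightarrow> 'a \<Rightarrow> nat" and n :: nat and p q :: real
  assumes p_pos: "0 < p" and p_le_1: "p \<le> 1" and q_eq: "q = 1 - p"
    and indep: "indep_vars (\<lambda>_. count_space UNIV) X {1..n}"
    and law: "\<And>j k. j \<in> {1..n} \<Longrightarrow> k \<ge> 1 \<Longrightarrow>
                prob {x \<in> space M. X j x = k} = p * q ^ (k - 1)"
begin

lemma q_nonneg: "0 \<le> q" and q_less_1: "q < 1"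
  using p_pos p_le_1 q_eq by auto

lemma measurable_letter: "j \<in> {1..n} \<Longrightarrow> X j \<in> measurable M (count_space UNIV)"
  using indep by (simp add: indep_vars_def2)

lemma letter_event: "j \<in> {1..n} \<Longrightarrow> {x \<in> space M. X j x = k} \<in> events"
  using measurable_sets[OF measurable_letter, of j "{k}"]
  by (simp add: vimage_def Int_def conj_commute)

text \<open>
  The geometric series \<open>p + p q + p q\<^sup>2 + \<dots>\<close> already has sum 1, which leaves no mass for the
  value 0.
\<close>

lemma AE_letter_pos:
  assumes "j \<in> {1..n}"
  shows "AE x in M. X j x \<ge> 1"
proof -
  let ?A = "\<lambda>k. {x \<in> space M. X j x = Suc k}"
  have "(\<lambda>k. prob (?A k)) sums prob (\<Union>k. ?A k)"
    using letter_event[OF assms]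
    by (intro finite_measure_UNION) (auto simp: disjoint_family_on_def)
  moreover have "(\<lambda>k. prob (?A k)) = (\<lambda>k. p * q ^ k)"
    using law[OF assms] by auto
  moreover have "(\<lambda>k. p * q ^ k) sums (p * (1 / (1 - q)))"
    by (intro sums_mult geometric_sums) (use q_nonneg q_less_1 in auto)
  ultimately have "prob (\<Union>k. ?A k) = 1"
    using p_pos by (auto simp: q_eq dest: sums_unique2)
  from AE_prob_1[OF this] show ?thesis
    by eventually_elim auto
qed

lemma prob_triple:
  assumes "k + 3 \<le> n" "1 \<le> a" "1 \<le> b" "1 \<le> a'"
  shows "prob {x \<in> space M. X (k + 1) x = a \<and> X (k + 2) x = b \<and> X (k + 3) x = a'} =
    p ^ 3 * (q ^ (a - 1) * q ^ (b - 1) * q ^ (a' - 1))"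
proof -
  let ?A = "\<lambda>j. if j = k + 1 then {a} else if j = k + 2 then {b} else {a'}"
  let ?J = "{k + 1, k + 2, k + 3}"
  have event: "X j -` {v} \<inter> space M = {x \<in> space M. X j x = v}" for j v
    by auto
  have "prob (\<Inter>j\<in>?J. X j -` ?A j \<inter> space M) = (\<Prod>j\<in>?J. prob (X j -` ?A j \<inter> space M))"
    by (rule indep_varsD[OF indep]) (use assms in auto)
  also have "\<dots> = p ^ 3 * (q ^ (a - 1) * q ^ (b - 1) * q ^ (a' - 1))"
    using assms by (simp add: event law power3_eq_cube)
  also have "(\<Inter>j\<in>?J. X j -` ?A j \<inter> space M) =
      {x \<in> space M. X (k + 1) x = a \<and> X (k + 2) x = b \<and> X (k + 3) x = a'}"
    by auto
  finally show ?thesis .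
qed

section \<open>The mean weight of one window\<close>

text \<open>
  A common form for peaks and valleys. The windows of positive letters on which the weight
  \<open>h\<close> can be nonzero are enumerated without repetition by \<open>i\<close> and \<open>d\<close>, with \<open>outer i d\<close> as first and last letter and
  \<open>inner i d\<close> as middle letter. The weight depends on \<open>d\<close> only and the probability is a product
  of a function of \<open>i\<close> and a function of \<open>d\<close>, so the mean is a product of two series. Since all terms
  are nonnegative, the computation takes place in the extended nonnegative reals, where sums and
  integrals commute freely; finiteness of the result then gives integrability.
\<close>

lemma has_bochner_integral_triple:
  fixes h :: "nat \<Rightarrow> nat \<Rightarrow> nat \<Rightarrow> real" and outer inner :: "nat \<Rightarrow> nat \<Rightarrow> nat"
  assumes k: "k + 3 \<le> n"
    and nonneg: "\<And>a b a'. 0 \<le> h a b a'"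
    and pos: "\<And>i d. 1 \<le> outer i d" "\<And>i d. 1 \<le> inner i d"
    and inj: "\<And>i d i' d'. outer i d = outer i' d' \<Longrightarrow> inner i d = inner i' d' \<Longrightarrow> i = i' \<and> d = d'"
    and supp: "\<And>a b a'. 1 \<le> a \<Longrightarrow> 1 \<le> b \<Longrightarrow> h a b a' \<noteq> 0 \<Longrightarrow>
                 \<exists>i d. a = outer i d \<and> b = inner i d \<and> a' = outer i d"
    and val: "\<And>i d. h (outer i d) (inner i d) (outer i d) = c (Suc d)"
    and weight: "\<And>i d. q ^ (outer i d - 1) * q ^ (inner i d - 1) * q ^ (outer i d - 1) =
                   q ^ (3 * i) * r ^ Suc d"
    and r: "0 \<le> r"
    and S: "(\<lambda>d. c (Suc d) * r ^ Suc d) sums S"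
  shows "has_bochner_integral M (\<lambda>x. h (X (k + 1) x) (X (k + 2) x) (X (k + 3) x))
           (p ^ 3 / (1 - q ^ 3) * S)"
proof (rule has_bochner_integral_nn_integral)
  let ?Z = "\<lambda>x. h (X (k + 1) x) (X (k + 2) x) (X (k + 3) x)"
  define E where "E i d = {x \<in> space M. X (k + 1) x = outer i d \<and> X (k + 2) x = inner i d \<and>
                            X (k + 3) x = outer i d}" for i d
  have letters: "k + 1 \<in> {1..n}" "k + 2 \<in> {1..n}" "k + 3 \<in> {1..n}"
    using k by auto
  note [measurable] = letters[THEN measurable_letter]
  have [measurable]: "E i d \<in> events" for i d
    unfolding E_def by measurable
  have c_nonneg: "0 \<le> c (Suc d)" for d
    using nonneg val by metis
  show "?Z \<in> borel_measurable M"
    by measurable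
  show "AE x in M. 0 \<le> ?Z x"
    using nonneg by simp
  have S_nonneg: "0 \<le> S"
    by (rule sums_le[OF _ sums_zero S]) (simp add: c_nonneg r)
  have q3: "0 \<le> q ^ 3" "q ^ 3 < 1"
    using q_nonneg q_less_1 by (auto simp: power_less_one_iff)
  show "0 \<le> p ^ 3 / (1 - q ^ 3) * S"
    using S_nonneg q3 p_pos by simp
  \<comment> \<open>The events \<open>E i d\<close> are pairwise disjoint, so at most one term of the double series is nonzero.\<close>
  have pointwise: "ennreal (?Z x) = (\<Sum>i. \<Sum>d. ennreal (c (Suc d)) * indicator (E i d) x)"
    if x: "x \<in> space M" "1 \<le> X (k + 1) x" "1 \<le> X (k + 2) x" for x
  proof (cases "\<exists>i d. x \<in> E i d")
    case True
    then obtain i0 d0 where x0: "x \<in> E i0 d0" by blast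
    have uniq: "x \<in> E i d \<longleftrightarrow> i = i0 \<and> d = d0" for i d
    proof
      assume "x \<in> E i d"
      with x0 have "outer i d = outer i0 d0" "inner i d = inner i0 d0"
        by (simp_all add: E_def)
      then show "i = i0 \<and> d = d0" by (rule inj)
    qed (use x0 in simp)
    have "(\<Sum>i. \<Sum>d. ennreal (c (Suc d)) * indicator (E i d) x) =
        (\<Sum>d. ennreal (c (Suc d)) * indicator (E i0 d) x)"
      by (rule suminf_single_ennreal) (simp add: uniq)
    also have "\<dots> = ennreal (c (Suc d0)) * indicator (E i0 d0) x"
      by (rule suminf_single_ennreal) (simp add: uniq)
    also have "\<dots> = ennreal (?Z x)"
      using x0 by (simp add: E_def val)
    finally show ?thesis ..
  next
    case False
    then have "?Z x = 0"
      using supp[OF x(2,3)] x(1) unfolding E_def by blast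
    with False show ?thesis by simp
  qed
  have "(\<integral>\<^sup>+x. ?Z x \<partial>M) =
      (\<integral>\<^sup>+x. (\<Sum>i. \<Sum>d. ennreal (c (Suc d)) * indicator (E i d) x) \<partial>M)"
  proof (rule nn_integral_cong_AE)
    show "AE x in M. ennreal (?Z x) = (\<Sum>i. \<Sum>d. ennreal (c (Suc d)) * indicator (E i d) x)"
      using AE_letter_pos[OF letters(1)] AE_letter_pos[OF letters(2)] AE_space
      by eventually_elim (rule pointwise)
  qed
  also have "\<dots> = (\<Sum>i. \<Sum>d. ennreal (c (Suc d)) * emeasure M (E i d))"
    by (simp add: nn_integral_suminf nn_integral_cmult_indicator)
  also have "\<dots> = (\<Sum>i. \<Sum>d. ennreal (p ^ 3 * q ^ (3 * i) * (c (Suc d) * r ^ Suc d)))"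
  proof (intro suminf_cong)
    fix i d
    have "prob (E i d) = p ^ 3 * (q ^ (3 * i) * r ^ Suc d)"
      unfolding E_def using prob_triple[OF k pos(1) pos(2) pos(1)] weight by simp
    then show "ennreal (c (Suc d)) * emeasure M (E i d) =
        ennreal (p ^ 3 * q ^ (3 * i) * (c (Suc d) * r ^ Suc d))"
      by (simp add: emeasure_eq_measure ennreal_mult'[symmetric] c_nonneg mult_ac del: power_Suc)
  qed
  also have "\<dots> = (\<Sum>i. ennreal (p ^ 3 * q ^ (3 * i) * S))"
    by (intro suminf_cong suminf_ennreal_eq sums_mult S)
      (use p_pos q_nonneg c_nonneg r in simp)
  also have "\<dots> = ennreal (p ^ 3 * (1 / (1 - q ^ 3)) * S)"
  proof (rule suminf_ennreal_eq)
    show "0 \<le> p ^ 3 * q ^ (3 * i) * S" for i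
      using p_pos q_nonneg S_nonneg by simp
    show "(\<lambda>i. p ^ 3 * q ^ (3 * i) * S) sums (p ^ 3 * (1 / (1 - q ^ 3)) * S)"
      unfolding power_mult
      by (intro sums_mult sums_mult2 geometric_sums) (use q3 in auto)
  qed
  finally show "(\<integral>\<^sup>+x. ?Z x \<partial>M) = ennreal (p ^ 3 / (1 - q ^ 3) * S)"
    by simp
qed

lemma has_bochner_integral_peak_weight:
  assumes k: "k + 3 \<le> n" and c: "\<And>d. 0 \<le> c d" and S: "(\<lambda>d. c (Suc d) * q ^ Suc d) sums S"
  shows "has_bochner_integral M
           (\<lambda>x. peak_weight c (X (k + 1) x) (X (k + 2) x) (X (k + 3) x)) (p ^ 3 / (1 - q ^ 3) * S)"
proof (rule has_bochner_integral_triple[where h = "peak_weight c" and c = c and k = k and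
      r = q and outer = "\<lambda>i d. Suc i" and
      inner = "\<lambda>i d. Suc i + Suc d", OF k _ _ _ _ _ _ _ q_nonneg S])
  show "\<exists>i d. a = Suc i \<and> b = Suc i + Suc d \<and> a' = Suc i"
    if "1 \<le> a" "peak_weight c a b a' \<noteq> 0" for a b a'
    using that by (intro exI[of _ "a - 1"] exI[of _ "b - a - 1"])
      (auto simp: peak_weight_def split: if_splits)
  show "q ^ (Suc i - 1) * q ^ (Suc i + Suc d - 1) * q ^ (Suc i - 1) = q ^ (3 * i) * q ^ Suc d"
    for i d
  proof -
    have "(Suc i - 1) + (Suc i + Suc d - 1) + (Suc i - 1) = 3 * i + Suc d" by simp
    then show ?thesis by (metis power_add)
  qed
qed (auto simp: peak_weight_def c)

lemma has_bochner_integral_valley_weight: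
  assumes k: "k + 3 \<le> n" and c: "\<And>d. 0 \<le> c d"
    and S: "(\<lambda>d. c (Suc d) * (q\<^sup>2) ^ Suc d) sums S"
  shows "has_bochner_integral M
           (\<lambda>x. valley_weight c (X (k + 1) x) (X (k + 2) x) (X (k + 3) x)) (p ^ 3 / (1 - q ^ 3) * S)"
proof (rule has_bochner_integral_triple[where h = "valley_weight c" and c = c and k = k and
      r = "q\<^sup>2" and outer = "\<lambda>i d. Suc i + Suc d" and
      inner = "\<lambda>i d. Suc i", OF k _ _ _ _ _ _ _ _ S])
  show "\<exists>i d. a = Suc i + Suc d \<and> b = Suc i \<and> a' = Suc i + Suc d"
    if "1 \<le> b" "valley_weight c a b a' \<noteq> 0" for a b a'
    using that by (intro exI[of _ "b - 1"] exI[of _ "a - b - 1"])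
      (auto simp: valley_weight_def split: if_splits)
  show "q ^ (Suc i + Suc d - 1) * q ^ (Suc i - 1) * q ^ (Suc i + Suc d - 1) =
      q ^ (3 * i) * (q\<^sup>2) ^ Suc d" for i d
  proof -
    have "(Suc i + Suc d - 1) + (Suc i - 1) + (Suc i + Suc d - 1) = 3 * i + 2 * Suc d" by simp
    then show ?thesis by (metis power_add power_mult)
  qed
qed (auto simp: valley_weight_def c)

section \<open>The mean weight of a word\<close>

lemma has_bochner_integral_peak_sum:
  assumes "2 \<le> n" and c: "\<And>d. 0 \<le> c d" and S: "(\<lambda>d. c (Suc d) * q ^ Suc d) sums S"
  shows "has_bochner_integral M
           (\<lambda>x. \<Sum>i\<in>symmetric_peaks (sample_word X n x).
                  c (sample_word X n x ! (i + 1) - sample_word X n x ! i))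
           (p ^ 3 / (1 - q ^ 3) * S * (real n - 2))"
proof -
  have len: "length (sample_word X n x) = n" for x
    by (simp add: sample_word_def)
  have "has_bochner_integral M
      (\<lambda>x. \<Sum>i<n - 2. peak_weight c (X (i + 1) x) (X (i + 2) x) (X (i + 3) x))
      (\<Sum>i<n - 2. p ^ 3 / (1 - q ^ 3) * S)"
    by (intro has_bochner_integral_sum has_bochner_integral_peak_weight c S) simp
  moreover have "(\<Sum>i<n - 2. p ^ 3 / (1 - q ^ 3) * S) = p ^ 3 / (1 - q ^ 3) * S * (real n - 2)"
    using \<open>2 \<le> n\<close> by (simp add: of_nat_diff)
  moreover have "(\<Sum>i\<in>symmetric_peaks (sample_word X n x).
        c (sample_word X n x ! (i + 1) - sample_word X n x ! i)) =
      (\<Sum>i<n - 2. peak_weight c (X (i + 1) x) (X (i + 2) x) (X (i + 3) x))" for x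
    unfolding sum_symmetric_peaks len
    by (intro sum.cong) (simp_all add: nth_sample_word numeral_eq_Suc)
  ultimately show ?thesis by (simp only:)
qed

lemma has_bochner_integral_valley_sum:
  assumes "2 \<le> n" and c: "\<And>d. 0 \<le> c d" and S: "(\<lambda>d. c (Suc d) * (q\<^sup>2) ^ Suc d) sums S"
  shows "has_bochner_integral M
           (\<lambda>x. \<Sum>i\<in>symmetric_valleys (sample_word X n x).
                  c (sample_word X n x ! i - sample_word X n x ! (i + 1)))
           (p ^ 3 / (1 - q ^ 3) * S * (real n - 2))"
proof -
  have len: "length (sample_word X n x) = n" for x
    by (simp add: sample_word_def)
  have "has_bochner_integral M
      (\<lambda>x. \<Sum>i<n - 2. valley_weight c (X (i + 1) x) (X (i + 2) x) (X (i + 3) x))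
      (\<Sum>i<n - 2. p ^ 3 / (1 - q ^ 3) * S)"
    by (intro has_bochner_integral_sum has_bochner_integral_valley_weight c S) simp
  moreover have "(\<Sum>i<n - 2. p ^ 3 / (1 - q ^ 3) * S) = p ^ 3 / (1 - q ^ 3) * S * (real n - 2)"
    using \<open>2 \<le> n\<close> by (simp add: of_nat_diff)
  moreover have "(\<Sum>i\<in>symmetric_valleys (sample_word X n x).
        c (sample_word X n x ! i - sample_word X n x ! (i + 1))) =
      (\<Sum>i<n - 2. valley_weight c (X (i + 1) x) (X (i + 2) x) (X (i + 3) x))" for x
    unfolding sum_symmetric_valleys len
    by (intro sum.cong) (simp_all add: nth_sample_word numeral_eq_Suc)
  ultimately show ?thesis by (simp only:)
qed

end

section \<open>The four expected values\<close>

text \<open>The factor 1 is the weight \<open>c\<close> that counts peaks or valleys.\<close>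

lemma geometric_sums_from_1:
  fixes r :: real
  assumes "\<bar>r\<bar> < 1"
  shows "(\<lambda>d. 1 * r ^ Suc d) sums (r / (1 - r))"
  using sums_mult[OF geometric_sums[of r], of r] assms by simp

lemma arithmetico_geometric_sums_from_1:
  fixes r :: real
  assumes "\<bar>r\<bar> < 1"
  shows "(\<lambda>d. real (Suc d) * r ^ Suc d) sums (r / (1 - r)\<^sup>2)"
  using sums_mult[OF geometric_deriv_sums[of r], of r] assms
  by (simp add: mult_ac del: of_nat_Suc)

theorem theorem9:
  fixes M :: "'a measure" and X :: "nat \<Rightarrow> 'a \<Rightarrow> nat" and n :: nat and p q :: real
  assumes "prob_space M"
    and "0 < p" and "p \<le> 1" and "q = 1 - p"
    and "n \<ge> 2"
    and "prob_space.indep_vars M (\<lambda>_. count_space UNIV) X {1..n}"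
    and "\<And>j k. j \<in> {1..n} \<Longrightarrow> k \<ge> 1 \<Longrightarrow>
           measure M {x \<in> space M. X j x = k} = p * q ^ (k - 1)"
  shows "(integrable M (\<lambda>x. real (sp (sample_word X n x))) \<and>
          (LINT x|M. real (sp (sample_word X n x))) =
            p\<^sup>2 * q / (1 - q ^ 3) * (real n - 2)) \<and>
         (integrable M (\<lambda>x. real (sv (sample_word X n x))) \<and>
          (LINT x|M. real (sv (sample_word X n x))) =
            p\<^sup>2 * (1 / (1 - q\<^sup>2) - 1 / (1 - q ^ 3)) * (real n - 2)) \<and>
         (integrable M (\<lambda>x. real (hsp (sample_word X n x))) \<and>
          (LINT x|M. real (hsp (sample_word X n x))) =
            p * q / (1 - q ^ 3) * (real n - 2)) \<and>
         (integrable M (\<lambda>x. real (dsv (sample_word X n x))) \<and>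
          (LINT x|M. real (dsv (sample_word X n x))) =
            q * (p / (1 - q ^ 3) - 1 / (1 + q)\<^sup>2) * (real n - 2))"
proof -
  interpret geometric_sample M X n p q
    by (intro geometric_sample.intro geometric_sample_axioms.intro assms)
  have r: "\<bar>q\<bar> < 1" "\<bar>q\<^sup>2\<bar> < 1"
    using q_nonneg q_less_1 by (auto simp: power_less_one_iff)
  \<comment> \<open>With \<open>1 - q ^ 3 = p * t\<close> and \<open>1 - q\<^sup>2 = p * s\<close>, the factors \<open>p\<close> cancel and the remaining
    denominators \<open>s\<close> and \<open>t\<close> are positive.\<close>
  define s where "s = 1 + q"
  define t where "t = 1 + q + q\<^sup>2"
  have pos: "0 < s" "0 < t"
    using q_nonneg by (auto simp: s_def t_def intro: add_pos_nonneg)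
  have cube: "1 - q ^ 3 = p * t" and square: "1 - q\<^sup>2 = p * s" and p: "1 - q = p"
    by (simp_all add: s_def t_def q_eq power2_eq_square power3_eq_cube algebra_simps)
  have sp: "has_bochner_integral M (\<lambda>x. real (sp (sample_word X n x)))
      (p\<^sup>2 * q / (1 - q ^ 3) * (real n - 2))"
  proof -
    have "p ^ 3 / (1 - q ^ 3) * (q / (1 - q)) = p\<^sup>2 * q / (1 - q ^ 3)"
      unfolding cube p using p_pos pos by (simp add: field_simps power2_eq_square power3_eq_cube)
    then show ?thesis
      using has_bochner_integral_peak_sum[OF \<open>n \<ge> 2\<close> _ geometric_sums_from_1[OF r(1)]]
      by (simp add: sp_def)
  qed
  have sv: "has_bochner_integral M (\<lambda>x. real (sv (sample_word X n x)))
      (p\<^sup>2 * (1 / (1 - q\<^sup>2) - 1 / (1 - q ^ 3)) * (real n - 2))"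
  proof -
    have "1 / (1 - q\<^sup>2) - 1 / (1 - q ^ 3) = (t - s) / (p * t * s)"
      unfolding cube square using p_pos pos by (simp add: divide_simps)
    also have "t - s = q\<^sup>2"
      by (simp add: s_def t_def)
    finally have diff: "1 / (1 - q\<^sup>2) - 1 / (1 - q ^ 3) = q\<^sup>2 / (p * t * s)" .
    have "p ^ 3 / (1 - q ^ 3) * (q\<^sup>2 / (1 - q\<^sup>2)) =
        p\<^sup>2 * (1 / (1 - q\<^sup>2) - 1 / (1 - q ^ 3))"
      unfolding diff unfolding cube square using p_pos pos
      by (simp add: field_simps power2_eq_square power3_eq_cube)
    then show ?thesis
      using has_bochner_integral_valley_sum[OF \<open>n \<ge> 2\<close> _ geometric_sums_from_1[OF r(2)]]
      by (simp add: sv_def)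
  qed
  have hsp: "has_bochner_integral M (\<lambda>x. real (hsp (sample_word X n x)))
      (p * q / (1 - q ^ 3) * (real n - 2))"
  proof -
    have "p ^ 3 / (1 - q ^ 3) * (q / (1 - q)\<^sup>2) = p * q / (1 - q ^ 3)"
      unfolding cube p using p_pos pos by (simp add: field_simps power2_eq_square power3_eq_cube)
    then show ?thesis
      using has_bochner_integral_peak_sum[OF \<open>n \<ge> 2\<close> _ arithmetico_geometric_sums_from_1[OF r(1)]]
      by (simp add: hsp_def)
  qed
  have dsv: "has_bochner_integral M (\<lambda>x. real (dsv (sample_word X n x)))
      (q * (p / (1 - q ^ 3) - 1 / (1 + q)\<^sup>2) * (real n - 2))"
  proof -
    have "p / (1 - q ^ 3) - 1 / (1 + q)\<^sup>2 = (s\<^sup>2 - t) / (t * s\<^sup>2)"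
      unfolding cube s_def[symmetric] using p_pos pos by (simp add: divide_simps)
    also have "s\<^sup>2 - t = q"
      by (simp add: s_def t_def power2_eq_square algebra_simps)
    finally have diff: "p / (1 - q ^ 3) - 1 / (1 + q)\<^sup>2 = q / (t * s\<^sup>2)" .
    have "p ^ 3 / (1 - q ^ 3) * (q\<^sup>2 / (1 - q\<^sup>2)\<^sup>2) =
        q * (p / (1 - q ^ 3) - 1 / (1 + q)\<^sup>2)"
      unfolding diff unfolding cube square using p_pos pos
      by (simp add: field_simps power2_eq_square power3_eq_cube)
    then show ?thesis
      using has_bochner_integral_valley_sum[OF \<open>n \<ge> 2\<close> _ arithmetico_geometric_sums_from_1[OF r(2)]]
      by (simp add: dsv_def)
  qed
  from sp sv hsp dsv show ?thesis
    by (simp add: has_bochner_integral_iff)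
qed

end
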